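(* Let $A, B \in \mathbb{R}^{n\times n}$. The generalized absolute value equation $Ax + B|x| = b$ has a unique solution $x \in \mathbb{R}^n$ for every $b \in \mathbb{R}^{n}$ if and only if the matrix $A - B + 2BD$ is nonsingular for every diagonal matrix $D = \mathrm{diag}(d_{i}) \in \mathbb{R}^{n\times n}$ with $0 \leq d_{i} \leq 1$ for all $i$.
   Context: For $x \in \mathbb{R}^n$, $|x|$ denotes the componentwise absolute value of $x$. *)

theory Defs
  imports "HOL-Analysis.Analysis"
begin

text \<open>
  The absolute value \<open>\<bar>x\<bar>\<close> of a vector is the library's, which is componentwise (\<open>abs_vec_def\<close>).
\<close>

definition diag_matrix :: "real ^ 'n \<Rightarrow> real ^ 'n ^ 'n" where
  "diag_matrix d = (\<chi> i j. if i = j then d $ i else 0)"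

end

theory Submission
  imports Defs
begin

text \<open>
  The numbers \<open>(\<bar>r\<bar> - \<bar>s\<bar>) / (r - s)\<close> with \<open>r \<noteq> s\<close> fill exactly \<open>[-1, 1]\<close>. Hence the vectors
  \<open>(A - B + 2BD)v\<close> with \<open>v \<noteq> 0\<close> and \<open>D\<close> in the unit box are exactly the differences
  \<open>f x - f y\<close> with \<open>x \<noteq> y\<close>, where \<open>f x = A x + B\<bar>x\<bar>\<close>, and nonsingularity for all \<open>D\<close> is the same as
  injectivity of \<open>f\<close>. An injective \<open>f\<close> is automatically surjective: its image is open by invariance
  of domain, and closed because positive homogeneity makes \<open>f\<close> proper.
\<close>

lemma abs_diff_slope:
  fixes r s :: real
  obtains e where "0 \<le> e" "e \<le> 1" "\<bar>r\<bar> - \<bar>s\<bar> = (2 * e - 1) * (r - s)"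
proof (cases "r = s")
  case True
  then show ?thesis using that[of 0] by simp
next
  case False
  define q where "q = (\<bar>r\<bar> - \<bar>s\<bar>) / (r - s)"
  have "\<bar>\<bar>r\<bar> - \<bar>s\<bar>\<bar> \<le> \<bar>r - s\<bar>" by (rule abs_triangle_ineq3)
  then have "\<bar>q\<bar> \<le> 1" using False by (simp add: q_def)
  moreover have "\<bar>r\<bar> - \<bar>s\<bar> = q * (r - s)" using False by (simp add: q_def)
  \<comment> \<open>The witness solves \<open>2 * e - 1 = q\<close>; since
    \<open>\<bar>q\<bar> \<le> 1\<close>, it lies in \<open>[0, 1]\<close>.\<close>
  ultimately show ?thesis using that[of "(1 + q) / 2"] by (simp add: field_simps)
qed

text \<open>Place a segment of length \<open>\<bar>v\<bar>\<close> around 0 with the fraction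
  \<open>e\<close> of it on the nonnegative side. The sign of \<open>v\<close> decides which
  endpoint is \<open>r\<close> and which is \<open>s\<close>.\<close>

lemma abs_diff_slope_attained:
  fixes e v :: real
  assumes "0 \<le> e" "e \<le> 1"
  obtains r s where "r - s = v" "\<bar>r\<bar> - \<bar>s\<bar> = (2 * e - 1) * v"
proof -
  have abs: "\<bar>e * v\<bar> = e * \<bar>v\<bar>" "\<bar>(1 - e) * v\<bar> = (1 - e) * \<bar>v\<bar>"
    using assms by (simp_all add: abs_mult)
  show ?thesis
  proof (cases "0 \<le> v")
    case True
    then have "\<bar>e * v\<bar> - \<bar>- ((1 - e) * v)\<bar> = (2 * e - 1) * v"
      unfolding abs_minus_cancel abs by (simp add: algebra_simps)
    then show ?thesis by (intro that[of "e * v" "- ((1 - e) * v)"]) (simp_all add: algebra_simps)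
  next
    case False
    then have "\<bar>(1 - e) * v\<bar> - \<bar>- (e * v)\<bar> = (2 * e - 1) * v"
      unfolding abs_minus_cancel abs by (simp add: algebra_simps)
    then show ?thesis by (intro that[of "(1 - e) * v" "- (e * v)"]) (simp_all add: algebra_simps)
  qed
qed

lemma abs_vec_nth [simp]: "\<bar>x :: real ^ 'n\<bar> $ i = \<bar>x $ i\<bar>"
  by (simp add: abs_vec_def)

lemma diag_matrix_mult_vec_nth [simp]: "(diag_matrix d *v x) $ i = d $ i * x $ i"
proof -
  have "(\<Sum>j\<in>UNIV. (if i = j then d $ i else 0) * x $ j) = (\<Sum>j\<in>UNIV. if j = i then d $ i * x $ j else 0)"
    by (rule sum.cong) auto
  then show ?thesis by (simp add: diag_matrix_def matrix_vector_mult_def)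
qed

text \<open>With \<open>D = diag_matrix d\<close>, the hypothesis reads
  \<open>\<bar>x\<bar> - \<bar>y\<bar> = (2D - I)(x - y)\<close>. Applying \<open>B\<close> and
  adding \<open>A(x - y)\<close> produces the matrix \<open>A - B + 2BD\<close>.\<close>

lemma abs_equation_diff:
  fixes A B :: "real ^ 'n ^ 'n"
  assumes "\<And>i. \<bar>x $ i\<bar> - \<bar>y $ i\<bar> = (2 * d $ i - 1) * (x $ i - y $ i)"
  shows "(A *v x + B *v \<bar>x\<bar>) - (A *v y + B *v \<bar>y\<bar>) =
    (A - B + 2 *\<^sub>R (B ** diag_matrix d)) *v (x - y)"
proof -
  have *: "\<bar>x\<bar> - \<bar>y\<bar> = 2 *\<^sub>R (diag_matrix d *v (x - y)) - (x - y)"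
    using assms by (simp add: vec_eq_iff algebra_simps)
  have "(A *v x + B *v \<bar>x\<bar>) - (A *v y + B *v \<bar>y\<bar>) = A *v (x - y) + B *v (\<bar>x\<bar> - \<bar>y\<bar>)"
    by (simp add: matrix_vector_mult_diff_distrib)
  also have "\<dots> = (A - B + 2 *\<^sub>R (B ** diag_matrix d)) *v (x - y)"
    unfolding * by (simp add: matrix_vector_mult_diff_distrib matrix_vector_mult_diff_rdistrib
        matrix_vector_mult_add_rdistrib matrix_vector_mul_assoc[symmetric] scaleR_matrix_vector_assoc[symmetric]
        matrix_vector_mult_scaleR scaleR_diff_right)
  finally show ?thesis .
qed

lemma invertible_iff_kernel_trivial:
  fixes M :: "real ^ 'n ^ 'n"
  shows "invertible M \<longleftrightarrow> (\<forall>v. M *v v = 0 \<longrightarrow> v = 0)"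
  by (simp add: invertible_left_inverse matrix_left_invertible_ker)

lemma inj_abs_equation_iff:
  fixes A B :: "real ^ 'n ^ 'n"
  shows "inj (\<lambda>x. A *v x + B *v \<bar>x\<bar>) \<longleftrightarrow>
    (\<forall>d :: real ^ 'n. (\<forall>i. 0 \<le> d $ i \<and> d $ i \<le> 1) \<longrightarrow>
      invertible (A - B + 2 *\<^sub>R (B ** diag_matrix d)))"
    (is "inj ?f \<longleftrightarrow> (\<forall>d. ?box d \<longrightarrow> invertible (?M d))")
proof
  assume inj: "inj ?f"
  show "\<forall>d. ?box d \<longrightarrow> invertible (?M d)"
  proof (intro allI impI)
    fix d :: "real ^ 'n"
    assume box: "?box d"
    show "invertible (?M d)"
      unfolding invertible_iff_kernel_trivial
    proof (intro allI impI)
      fix v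
      assume ker: "?M d *v v = 0"
      \<comment> \<open>The kernel vector \<open>v\<close> is realised coordinate by coordinate as a
        difference of two points on which \<open>?f\<close> agrees; injectivity then forces it to
        vanish.\<close>
      have "\<exists>r s. r - s = v $ i \<and> \<bar>r\<bar> - \<bar>s\<bar> = (2 * d $ i - 1) * v $ i" for i
        using abs_diff_slope_attained[of "d $ i" "v $ i"] box by metis
      then obtain r s where rs: "\<And>i. r i - s i = v $ i"
        "\<And>i. \<bar>r i\<bar> - \<bar>s i\<bar> = (2 * d $ i - 1) * v $ i"
        by metis
      define x y :: "real ^ 'n" where "x = (\<chi> i. r i)" and "y = (\<chi> i. s i)"
      have v: "x - y = v" by (simp add: x_def y_def vec_eq_iff rs)
      have "?f x - ?f y = ?M d *v (x - y)"
        by (rule abs_equation_diff) (simp add: x_def y_def rs)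
      then have "?f x = ?f y" by (simp add: v ker)
      then have "x = y" by (rule injD[OF inj])
      then show "v = 0" using v by simp
    qed
  qed
next
  assume inv: "\<forall>d. ?box d \<longrightarrow> invertible (?M d)"
  show "inj ?f"
  proof (rule injI)
    fix x y
    assume eq: "?f x = ?f y"
    have "\<exists>e. 0 \<le> e \<and> e \<le> 1 \<and> \<bar>x $ i\<bar> - \<bar>y $ i\<bar> = (2 * e - 1) * (x $ i - y $ i)" for i
      using abs_diff_slope[of "x $ i" "y $ i"] by metis
    then obtain e where e: "\<And>i. 0 \<le> e i \<and> e i \<le> 1"
      "\<And>i. \<bar>x $ i\<bar> - \<bar>y $ i\<bar> = (2 * e i - 1) * (x $ i - y $ i)"
      by metis
    \<comment> \<open>The slopes of the separate coordinates form one point of the box, and its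
      matrix annihilates \<open>x - y\<close>.\<close>
    define d :: "real ^ 'n" where "d = (\<chi> i. e i)"
    have "?f x - ?f y = ?M d *v (x - y)"
      by (rule abs_equation_diff) (simp add: d_def e)
    then have "?M d *v (x - y) = 0" using eq by simp
    moreover have "invertible (?M d)" using inv e(1) by (simp add: d_def)
    ultimately have "x - y = 0" unfolding invertible_iff_kernel_trivial by blast
    then show "x = y" by simp
  qed
qed

lemma surj_if_inj_proper:
  fixes f :: "'a::euclidean_space \<Rightarrow> 'a"
  assumes cont: "continuous_on UNIV f" and inj: "inj f"
    and proper: "\<And>r. bounded (f -` cball 0 r)"
  shows "surj f"
proof -
  have "open (range f)"
    using invariance_of_domain[OF cont open_UNIV inj] .
  moreover have "closed (range f)"
  proof -
    have "b \<in> range f" if b: "b \<in> closure (range f)" for b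
    proof -
      \<comment> \<open>Only arguments in \<open>S\<close> have values within distance 1 of
        \<open>b\<close>. Compactness of \<open>S\<close> makes its image closed, so a limit of
        values close to \<open>b\<close> is again a value.\<close>
      define S where "S = f -` cball b 1"
      have "cball b 1 \<subseteq> cball 0 (norm b + 1)" by (simp add: cball_subset_cball_iff)
      then have "bounded S"
        unfolding S_def by (meson bounded_subset proper vimage_mono)
      moreover have "closed S"
        unfolding S_def using cont by (simp add: closed_vimage)
      ultimately have "compact S" by (simp add: compact_eq_bounded_closed)
      then have closed: "closed (f ` S)"
        using cont by (meson compact_continuous_image compact_imp_closed continuous_on_subset top_greatest)
      have "b \<in> ball b 1 \<inter> closure (range f)" using b by simp
      then have "b \<in> closure (ball b 1 \<inter> range f)"
        using open_Int_closure_subset[of "ball b 1" "range f"] by blast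
      also have "\<dots> \<subseteq> f ` S"
        using closed by (intro closure_minimal) (auto simp: S_def)
      finally show ?thesis by blast
    qed
    then show ?thesis by (metis closure_subset_eq subsetI)
  qed
  \<comment> \<open>By connectedness, a set that is both open and closed is empty or the whole
    space, and a range is nonempty.\<close>
  ultimately show ?thesis using clopen[of "range f"] by blast
qed

text \<open>By compactness, \<open>norm (f x)\<close> attains a minimum on the unit sphere, positive
  since \<open>f\<close> vanishes at most at 0. Scaling turns it into a linear lower bound for
  \<open>norm (f x)\<close> in terms of \<open>norm x\<close>.\<close>

lemma bounded_vimage_if_pos_homogeneous:
  fixes f :: "'a::euclidean_space \<Rightarrow> 'b::real_normed_vector"
  assumes cont: "continuous_on UNIV f"
    and hom: "\<And>t x. 0 \<le> t \<Longrightarrow> f (t *\<^sub>R x) = t *\<^sub>R f x"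
    and nz: "\<And>x. f x = 0 \<Longrightarrow> x = 0"
  shows "bounded (f -` cball 0 r)"
proof -
  have "continuous_on (sphere 0 1) (\<lambda>x. norm (f x))"
    by (intro continuous_on_norm continuous_on_subset[OF cont]) auto
  then obtain u :: 'a where u: "norm u = 1" "\<And>x. norm x = 1 \<Longrightarrow> norm (f u) \<le> norm (f x)"
    using continuous_attains_inf[of "sphere 0 (1::real)" "\<lambda>x::'a. norm (f x)"] by auto
  have pos: "norm (f u) > 0" using nz[of u] u(1) by auto
  have "norm (f u) * norm x \<le> norm (f x)" for x
  proof (cases "x = 0")
    case False
    have "norm (f u) \<le> norm (f ((1 / norm x) *\<^sub>R x))" using False by (intro u(2)) simp
    also have "\<dots> = norm (f x) / norm x" by (subst hom) auto
    finally show ?thesis using False by (simp add: field_simps)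
  qed simp
  then have "norm x \<le> r / norm (f u)" if "norm (f x) \<le> r" for x
    using that pos by (simp add: field_simps) (metis order_trans)
  then show ?thesis
    unfolding bounded_iff by (intro exI[of _ "r / norm (f u)"]) auto
qed

lemma bij_abs_equation_if_inj:
  fixes A B :: "real ^ 'n ^ 'n"
  assumes inj: "inj (\<lambda>x. A *v x + B *v \<bar>x\<bar>)"
  shows "bij (\<lambda>x. A *v x + B *v \<bar>x\<bar>)"
proof -
  let ?f = "\<lambda>x. A *v x + B *v \<bar>x\<bar>"
  have "continuous_on UNIV (\<lambda>x :: real ^ 'n. \<bar>x\<bar>)"
    unfolding abs_vec_def by (intro continuous_intros)
  then have cont: "continuous_on UNIV ?f"
    by (intro continuous_on_add matrix_vector_mult_linear_continuous_on
        continuous_on_compose2[OF matrix_vector_mult_linear_continuous_on[of UNIV B]]) auto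
  have hom: "?f (t *\<^sub>R x) = t *\<^sub>R ?f x" if "0 \<le> t" for t x
  proof -
    have "\<bar>t *\<^sub>R x\<bar> = t *\<^sub>R \<bar>x\<bar>" using that by (simp add: vec_eq_iff abs_mult)
    then show ?thesis by (simp add: matrix_vector_mult_scaleR scaleR_add_right)
  qed
  have "?f 0 = 0" by simp
  \<comment> \<open>Injectivity is used twice: here it leaves 0 as the only zero, which gives
    properness, and below it yields openness of the range.\<close>
  then have nz: "x = 0" if "?f x = 0" for x
    using inj that by (metis (no_types, lifting) injD)
  have "surj ?f"
    using cont inj bounded_vimage_if_pos_homogeneous[OF cont hom nz] by (rule surj_if_inj_proper)
  then show ?thesis using inj by (simp add: bij_def)
qed

theorem corollary3p3:
  fixes A B :: "real ^ 'n ^ 'n"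
  shows "(\<forall>b :: real ^ 'n. \<exists>!x :: real ^ 'n. A *v x + B *v \<bar>x\<bar> = b) \<longleftrightarrow>
    (\<forall>d :: real ^ 'n. (\<forall>i. 0 \<le> d $ i \<and> d $ i \<le> 1) \<longrightarrow>
      invertible (A - B + 2 *\<^sub>R (B ** diag_matrix d)))"
proof -
  \<comment> \<open>Existence for all \<open>b\<close> is surjectivity and uniqueness is
    injectivity; the next step removes surjectivity because it follows from injectivity.\<close>
  have "(\<forall>b. \<exists>!x. A *v x + B *v \<bar>x\<bar> = b) \<longleftrightarrow> bij (\<lambda>x. A *v x + B *v \<bar>x\<bar>)"
    unfolding bij_iff by metis
  also have "\<dots> \<longleftrightarrow> inj (\<lambda>x. A *v x + B *v \<bar>x\<bar>)"
    using bij_abs_equation_if_inj bij_is_inj by blast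
  finally show ?thesis unfolding inj_abs_equation_iff .
qed

end
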